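(* Let $\Sigma$ be a finite set of models, let $G$ be a weighted graph (directed or undirected) on vertex set $\Sigma$ with positive edge lengths satisfying the feedback property described in the context, and let $s^*\in\Sigma$ be the unknown target. Assume all feedback is correct ($p=1$). Let $S_{\mathrm{init}}\subseteq\Sigma$ with $s^*\in S_{\mathrm{init}}$, and let $N_0=|S_{\mathrm{init}}|$. Let $0<\beta<1$. Run the following algorithm: set $S\leftarrow S_{\mathrm{init}}$; while $|S|>1$, choose a model $s$, propose it, receive the feedback $s'$, and set $S\leftarrow S\cap N(s,s')$; finally return the unique model in $S$. If every model $s$ chosen in the loop satisfies $\Phi_{S}(s)\le\beta$ (for the current set $S$), then the algorithm returns $s^*$ after at most $\log_{1/\beta} N_0$ queries.
   Context: Models and feedback graph: $\Sigma$ is a finite set of candidate models. $G$ is a (directed or undirected) graph with one node per model and edges $(s,s')$ with arbitrary positive lengths $\omega(s,s')>0$; distances $d(\cdot,\cdot)$ are shortest-path distances w.r.t. these lengths. Interaction: in each round the algorithm proposes a model $s$ and the user responds with a model $s'$. Correct feedback: if $s=s^*$ the response is $s'=s$; otherwise the response is some $s'\neq s$ with $(s,s')$ an edge of $G$ such that $s'$ lies on a shortest path from $s$ to $s^*$ in $G$ (no guarantee which such $s'$ is given). For models $s,s'$ define $N(s,s')=\{s\}$ if $s'=s$, and $N(s,s')=\{\hat s: s' \text{ lies on a shortest path from } s \text{ to } \hat s\}$ if $s'\neq s$. For node weights $\mu:\Sigma\to\mathbb{R}_{\ge0}$ write $\mu(S)=\sum_{s\in S}\mu(s)$ and define $\Phi_\mu(s)=\frac{1}{\mu(\Sigma)}\max_{s'\neq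 s,\,(s,s')\in G}\mu(N(s,s'))$. For a set $S$, $\Phi_S(s)$ denotes $\Phi_{\mu_S}(s)$ where $\mu_S$ is $1$ on $S$ and $0$ elsewhere. *)

theory Defs
  imports
    Complex_Main
    "HOL-Library.While_Combinator"
    "HOL-Library.Indicator_Function"
    "Graph_Theory.Pair_Digraph"
    "Graph_Theory.Shortest_Path"
begin

text \<open>
  A graph with vertex set \<open>\<Sigma> = pverts G\<close> and edge lengths \<open>\<omega>\<close>. An undirected graph is the
  special case of a symmetric arc set with symmetric lengths.
  The shortest-path distance is the library's \<open>wf_digraph.\<mu>\<close>, which is \<open>\<infinity>\<close> for unreachable
  vertices, so that no shortest path exists in that case.
\<close>

definition shortest_path ::
  "'a pair_pre_digraph \<Rightarrow> ('a \<times> 'a) weight_fun \<Rightarrow> 'a \<Rightarrow> ('a \<times> 'a) awalk \<Rightarrow> 'a \<Rightarrow> bool" where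
  "shortest_path G \<omega> u p v \<longleftrightarrow>
     pre_digraph.apath (with_proj G) u p v \<and>
     ereal (wf_digraph.awalk_cost \<omega> p) = wf_digraph.\<mu> (with_proj G) \<omega> u v"

definition on_shortest_path ::
  "'a pair_pre_digraph \<Rightarrow> ('a \<times> 'a) weight_fun \<Rightarrow> 'a \<Rightarrow> 'a \<Rightarrow> 'a \<Rightarrow> bool" where
  "on_shortest_path G \<omega> x u v \<longleftrightarrow>
     (\<exists>p. shortest_path G \<omega> u p v \<and> x \<in> set (pre_digraph.awalk_verts (with_proj G) u p))"

definition correct_feedback ::
  "'a pair_pre_digraph \<Rightarrow> ('a \<times> 'a) weight_fun \<Rightarrow> 'a \<Rightarrow> 'a \<Rightarrow> 'a \<Rightarrow> bool" where
  "correct_feedback G \<omega> target s s' \<longleftrightarrow>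
     (if s = target then s' = s
      else s' \<noteq> s \<and> (s, s') \<in> parcs G \<and> on_shortest_path G \<omega> s' s target)"

text \<open>
  The target is unknown, so a correct response has to exist for every proposed model and every
  possible target; in particular all distances are finite.
\<close>

definition feedback_graph :: "'a pair_pre_digraph \<Rightarrow> ('a \<times> 'a) weight_fun \<Rightarrow> bool" where
  "feedback_graph G \<omega> \<longleftrightarrow>
     pair_fin_digraph G \<and>
     (\<forall>e\<in>parcs G. 0 < \<omega> e) \<and>
     (\<forall>target\<in>pverts G. \<forall>s\<in>pverts G. \<exists>s'. correct_feedback G \<omega> target s s')"

definition consistent_models ::
  "'a pair_pre_digraph \<Rightarrow> ('a \<times> 'a) weight_fun \<Rightarrow> 'a \<Rightarrow> 'a \<Rightarrow> 'a set" where
  "consistent_models G \<omega> s s' =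
     (if s' = s then {s} else {t \<in> pverts G. on_shortest_path G \<omega> s' s t})"

text \<open>
  \<open>\<Phi>\<close> is only meaningful if \<open>s\<close> has an out-neighbour other than itself, which in a feedback graph
  is the case as soon as there are at least two models.
\<close>

definition Phi ::
  "'a pair_pre_digraph \<Rightarrow> ('a \<times> 'a) weight_fun \<Rightarrow> ('a \<Rightarrow> real) \<Rightarrow> 'a \<Rightarrow> real" where
  "Phi G \<omega> m s =
     (1 / sum m (pverts G)) *
     Max {sum m (consistent_models G \<omega> s s') | s'. s' \<noteq> s \<and> (s, s') \<in> parcs G}"

definition Phi_set ::
  "'a pair_pre_digraph \<Rightarrow> ('a \<times> 'a) weight_fun \<Rightarrow> 'a set \<Rightarrow> 'a \<Rightarrow> real" where
  "Phi_set G \<omega> S = Phi G \<omega> (indicator S)"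

text \<open>
  A state of the algorithm is the current set \<open>S\<close> together with the transcript of all queries made
  so far, as pairs of proposed model and response. Both the choice of the next model and the
  user's response may depend arbitrarily on the transcript.
\<close>

type_synonym 'a transcript = "('a \<times> 'a) list"

definition searching :: "'a set \<times> 'a transcript \<Rightarrow> bool" where
  "searching = (\<lambda>(S, h). card S > 1)"

definition search_step ::
  "'a pair_pre_digraph \<Rightarrow> ('a \<times> 'a) weight_fun \<Rightarrow> ('a transcript \<Rightarrow> 'a) \<Rightarrow>
   ('a transcript \<Rightarrow> 'a \<Rightarrow> 'a) \<Rightarrow> 'a set \<times> 'a transcript \<Rightarrow> 'a set \<times> 'a transcript" where
  "search_step G \<omega> propose respond =
     (\<lambda>(S, h). let s = propose h; s' = respond h s
               in (S \<inter> consistent_models G \<omega> s s', h @ [(s, s')]))"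

definition search ::
  "'a pair_pre_digraph \<Rightarrow> ('a \<times> 'a) weight_fun \<Rightarrow> ('a transcript \<Rightarrow> 'a) \<Rightarrow>
   ('a transcript \<Rightarrow> 'a \<Rightarrow> 'a) \<Rightarrow> 'a set \<Rightarrow> ('a set \<times> 'a transcript) option" where
  "search G \<omega> propose respond S_init =
     while_option searching (search_step G \<omega> propose respond) (S_init, [])"

text \<open>The states that occur at the loop head of the run.\<close>

inductive search_state ::
  "'a pair_pre_digraph \<Rightarrow> ('a \<times> 'a) weight_fun \<Rightarrow> ('a transcript \<Rightarrow> 'a) \<Rightarrow>
   ('a transcript \<Rightarrow> 'a \<Rightarrow> 'a) \<Rightarrow> 'a set \<Rightarrow> 'a set \<times> 'a transcript \<Rightarrow> bool"
  for G \<omega> propose respond S_init where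
  init: "search_state G \<omega> propose respond S_init (S_init, [])"
| step: "search_state G \<omega> propose respond S_init st \<Longrightarrow> searching st \<Longrightarrow>
         search_state G \<omega> propose respond S_init (search_step G \<omega> propose respond st)"

end

theory Submission
  imports Defs
begin

text \<open>
  Every query shrinks the set of remaining models by a factor of at least \<open>\<beta>\<close>, and correct
  feedback never removes the target; so \<open>n\<close> queries leave between \<open>1\<close> and \<open>\<beta>\<^sup>n N\<^sub>0\<close> models.
  If a model other than the target is proposed, the shrinking is immediate from the definition of
  \<open>\<Phi>\<^sub>S\<close>. If the target itself is proposed, a single model remains, and one needs \<open>1 \<le> \<beta> |S|\<close>:
  for another model \<open>t \<in> S\<close> the graph provides a neighbour \<open>s'\<close> of \<open>s\<close> on a shortest path to \<open>t\<close>,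
  so \<open>N(s, s')\<close> meets \<open>S\<close> and hence \<open>\<Phi>\<^sub>S(s) |S| \<ge> 1\<close>.
\<close>

text \<open>With indicator weights, a set of vertices weighs as much as it has elements in
  \<open>S\<close>. Multiplying by \<open>card S\<close> cancels the normalisation, leaving a
  maximum in which \<open>s'\<close> is one of the candidates.\<close>

lemma card_inter_consistent_models_le_Phi_set:
  assumes "pair_fin_digraph G" "S \<subseteq> pverts G" "s' \<noteq> s" "(s, s') \<in> parcs G"
  shows "real (card (S \<inter> consistent_models G \<omega> s s')) \<le> Phi_set G \<omega> S s * real (card S)"
proof -
  interpret pair_fin_digraph G by fact
  let ?m = "indicator S :: 'a \<Rightarrow> real"
  let ?M = "{sum ?m (consistent_models G \<omega> s s') | s'. s' \<noteq> s \<and> (s, s') \<in> parcs G}"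
  have sum_m: "sum ?m A = real (card (S \<inter> A))" if "A \<subseteq> pverts G" for A
    using finite_subset[OF that pair_finite_verts] by (simp add: indicator_def sum.If_cases Int_commute)
  \<comment> \<open>\<open>Max\<close> bounds its elements only for finite sets; here each candidate
    is indexed by an arc, and there are finitely many arcs.\<close>
  have "?M \<subseteq> (\<lambda>e. sum ?m (consistent_models G \<omega> s (snd e))) ` parcs G"
    by force
  then have "finite ?M"
    by (rule finite_subset) simp
  then have "sum ?m (consistent_models G \<omega> s s') \<le> Max ?M"
    by (rule Max_ge) (use assms in blast)
  moreover have "sum ?m (consistent_models G \<omega> s s') = real (card (S \<inter> consistent_models G \<omega> s s'))"
    by (rule sum_m) (use \<open>s' \<noteq> s\<close> in \<open>auto simp: consistent_models_def\<close>)
  \<comment> \<open>Cancelling needs \<open>card S\<close> nonzero. For empty \<open>S\<close> both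
    sides of the goal are 0.\<close>
  moreover have "Phi_set G \<omega> S s * real (card S) = Max ?M" if "S \<noteq> {}"
  proof -
    have "sum ?m (pverts G) = real (card S)"
      using sum_m[of "pverts G"] assms(2) by (simp add: Int_absorb2)
    moreover have "card S \<noteq> 0"
      using that finite_subset[OF assms(2) pair_finite_verts] by simp
    ultimately show ?thesis
      by (simp add: Phi_set_def Phi_def)
  qed
  ultimately show ?thesis
    by (cases "S = {}") auto
qed

text \<open>Kept general in \<open>target\<close>: it serves the true target and also a hypothetical
  one.\<close>

lemma target_in_consistent_models:
  assumes "correct_feedback G \<omega> target s s'" "target \<in> pverts G"
  shows "target \<in> consistent_models G \<omega> s s'"
  using assms by (auto simp: correct_feedback_def consistent_models_def split: if_splits)

text \<open>Extends the bound to the response \<open>s' = s\<close>, over which the maximum in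
  \<open>Phi\<close> does not range.\<close>

lemma card_consistent_le_Phi_set:
  assumes G: "feedback_graph G \<omega>" and S: "S \<subseteq> pverts G" "1 < card S" and s: "s \<in> pverts G"
    and fb: "correct_feedback G \<omega> target s s'"
  shows "real (card (S \<inter> consistent_models G \<omega> s s')) \<le> Phi_set G \<omega> S s * real (card S)"
proof (cases "s = target")
  case False
  with fb G S show ?thesis
    by (intro card_inter_consistent_models_le_Phi_set)
      (auto simp: correct_feedback_def feedback_graph_def)
next
  case True
  have fin: "finite S"
    using S(2) by (intro card_ge_0_finite) simp
  have "\<not> S \<subseteq> {s}"
    using S(2) card_mono[of "{s}" S] by auto
  then obtain t where t: "t \<in> S" "t \<noteq> s"
    by auto
  \<comment> \<open>\<open>s''\<close> is a response that would be correct if \<open>t\<close> were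
    the target; it need not occur in the run.\<close>
  then obtain s'' where fb': "correct_feedback G \<omega> t s s''"
    using G S s unfolding feedback_graph_def by blast
  have "card (S \<inter> consistent_models G \<omega> s s') \<le> card {s}"
    using True fb by (intro card_mono) (auto simp: correct_feedback_def consistent_models_def)
  also have "\<dots> \<le> card (S \<inter> consistent_models G \<omega> s s'')"
  proof -
    have "t \<in> S \<inter> consistent_models G \<omega> s s''"
      using t S target_in_consistent_models[OF fb'] by blast
    then have "0 < card (S \<inter> consistent_models G \<omega> s s'')"
      using fin by (subst card_gt_0_iff) auto
    then show ?thesis
      by simp
  qed
  finally have "real (card (S \<inter> consistent_models G \<omega> s s'))
      \<le> real (card (S \<inter> consistent_models G \<omega> s s''))"
    by simp
  also have "\<dots> \<le> Phi_set G \<omega> S s * real (card S)"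
    using fb' t(2) G S
    by (intro card_inter_consistent_models_le_Phi_set)
      (auto simp: correct_feedback_def feedback_graph_def)
  finally show ?thesis .
qed

theorem theorem1:
  fixes G :: "'a pair_pre_digraph" and \<omega> :: "('a \<times> 'a) weight_fun"
    and target :: 'a and S_init :: "'a set" and \<beta> :: real
    and propose :: "'a transcript \<Rightarrow> 'a" and respond :: "'a transcript \<Rightarrow> 'a \<Rightarrow> 'a"
  assumes "feedback_graph G \<omega>"
    and "target \<in> pverts G"
    and "S_init \<subseteq> pverts G"
    and "target \<in> S_init"
    and "0 < \<beta>" and "\<beta> < 1"
    and "\<And>S h. search_state G \<omega> propose respond S_init (S, h) \<Longrightarrow> searching (S, h) \<Longrightarrow>
           propose h \<in> pverts G"
    and "\<And>S h. search_state G \<omega> propose respond S_init (S, h) \<Longrightarrow> searching (S, h) \<Longrightarrow>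
           correct_feedback G \<omega> target (propose h) (respond h (propose h))"
    and "\<And>S h. search_state G \<omega> propose respond S_init (S, h) \<Longrightarrow> searching (S, h) \<Longrightarrow>
           Phi_set G \<omega> S (propose h) \<le> \<beta>"
  shows "\<exists>h. search G \<omega> propose respond S_init = Some ({target}, h) \<and>
             real (length h) \<le> log (1 / \<beta>) (real (card S_init))"
proof -
  let ?step = "search_step G \<omega> propose respond"
  \<comment> \<open>Reachability is included because the assumptions on proposals and responses
    cover only states of the run.\<close>
  define Inv where "Inv = (\<lambda>st. search_state G \<omega> propose respond S_init st \<and> target \<in> fst st \<and>
    fst st \<subseteq> S_init \<and> real (card (fst st)) \<le> \<beta> ^ length (snd st) * real (card S_init))"
  have fin: "finite S_init"
    using assms(1,3) finite_subset
    by (auto simp: feedback_graph_def pair_fin_digraph_def pair_fin_digraph_axioms_def)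
  have step: "Inv (?step st) \<and> card (fst (?step st)) < card (fst st)"
    if inv: "Inv st" and sea: "searching st" for st
  proof -
    obtain S h where st: "st = (S, h)"
      by (cases st)
    let ?s = "propose h" and ?s' = "respond h (propose h)"
    let ?S' = "S \<inter> consistent_models G \<omega> ?s ?s'"
    have state: "search_state G \<omega> propose respond S_init (S, h)"
      and S: "target \<in> S" "S \<subseteq> S_init" "real (card S) \<le> \<beta> ^ length h * real (card S_init)"
      using inv by (simp_all add: Inv_def st)
    note run = state sea[unfolded st]
    have "1 < card S"
      using sea by (simp add: st searching_def)
    have step_eq: "?step st = (?S', h @ [(?s, ?s')])"
      by (simp add: search_step_def st Let_def)
    have "real (card ?S') \<le> Phi_set G \<omega> S ?s * real (card S)"
      using S assms(3) \<open>1 < card S\<close>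
      by (intro card_consistent_le_Phi_set[OF assms(1) _ _ assms(7)[OF run] assms(8)[OF run]]) auto
    also have "\<dots> \<le> \<beta> * real (card S)"
      by (intro mult_right_mono assms(9)[OF run]) simp
    finally have shrink: "real (card ?S') \<le> \<beta> * real (card S)" .
    also have "\<dots> \<le> \<beta> * (\<beta> ^ length h * real (card S_init))"
      using S(3) assms(5) by simp
    finally have "Inv (?step st)"
      using search_state.step[OF run] S target_in_consistent_models[OF assms(8)[OF run] assms(2)]
      by (auto simp: Inv_def step_eq st[symmetric])
    \<comment> \<open>Since \<open>\<beta> < 1\<close>, the cardinality drops strictly and serves as
      termination measure.\<close>
    moreover have "\<beta> * real (card S) < 1 * real (card S)"
      using assms(6) \<open>1 < card S\<close> by (intro mult_strict_right_mono) auto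
    then have "card (fst (?step st)) < card (fst st)"
      using shrink by (simp add: step_eq) (simp add: st)
    ultimately show ?thesis ..
  qed
  have init: "Inv (S_init, [])"
    using assms(4) by (simp add: Inv_def search_state.init)
  obtain S h where run: "search G \<omega> propose respond S_init = Some (S, h)"
    using measure_while_option_Some[where P = Inv and b = searching and c = ?step, OF step init]
    by (auto simp: search_def)
  have "Inv (S, h)"
    using while_option_rule[where P = Inv, OF _ run[unfolded search_def] init] step by blast
  then have S: "target \<in> S" "S \<subseteq> S_init" "real (card S) \<le> \<beta> ^ length h * real (card S_init)"
    by (simp_all add: Inv_def)
  have "finite S"
    using S(2) fin by (rule finite_subset)
  have "card S \<le> 1"
    using while_option_stop[OF run[unfolded search_def]] by (simp add: searching_def)
  \<comment> \<open>The exit test alone would allow an empty \<open>S\<close>; the invariant keeps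
    \<open>target\<close> in it.\<close>
  then have "S = {target}"
    using S(1) \<open>finite S\<close> card_le_Suc0_iff_eq[of S] by auto
  have "1 \<le> \<beta> ^ length h * real (card S_init)"
    using S(3) \<open>S = {target}\<close> by simp
  then have "(1 / \<beta>) ^ length h \<le> real (card S_init)"
    using assms(5) by (simp add: power_one_over field_simps)
  then have "real (length h) \<le> log (1 / \<beta>) (real (card S_init))"
    using assms(5,6) by (intro le_log_of_power) auto
  with run \<open>S = {target}\<close> show ?thesis
    by blast
qed

end
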